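(* Let $\sigma$ be any finite signature, $P$ a $\sigma$-program, $\kappa\ge k_P$, and $n\ge1$. Let $A$ be any $\sigma$-structure and $M$ any BSS RAM in $\mathsf M_A\cup\mathsf M_A^{\mathrm{DND}}\cup\mathsf M_A^{\mathrm{ND}}\cup\mathsf M_A^{\mathrm{NDB}}$ with $P_M=P$ and $k_M=\kappa$. Let $(\ell_t\,.\,\vec\nu^{(t)})_{t\ge1}\in\mathrm{Seq}^{\mathrm{ind}}_{P,\kappa,n}$ be such that, for some $t\ge1$ with $\ell_t\in L_{P,\mathrm{H_T}}$, $\ell_{t+1}\ne T^{(\kappa)}_{\ell_t}(\vec\nu^{(t)})$. Then the $P$-path $B_{\bar\ell}$ given by $\bar\ell=(\ell_t)_{t\ge1}$ cannot be traversed by $M$ for any input of length $n$ (i.e. $B_{\bar\ell}\notin\mathrm{Lab}_{M,n}$).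
   Context: **Programs.** $\mathbb N_+$ denotes the positive integers. Let $\sigma=(n_1;m_1,\ldots,m_{n_2};k_1,\ldots,k_{n_3})$ be a finite signature with constant symbols $c_i^0$, operation symbols $f_i^{m_i}$, relation symbols $r_i^{k_i}$. A $\sigma$-program $P$ is a list $1:\mathrm{instruction}_1;\ \ldots;\ \ell_P-1:\mathrm{instruction}_{\ell_P-1};\ \ell_P:\text{stop}$ with $\ell_P\ge1$, where each instruction with label $\ell<\ell_P$ has one of the forms: (1) $Z_j:=f_i^{m_i}(Z_{j_1},\ldots,Z_{j_{m_i}})$; (2) $Z_j:=c_i^0$; (3) $Z_{I_j}:=Z_{I_k}$; (4) if $r_i^{k_i}(Z_{j_1},\ldots,Z_{j_{k_i}})$ then goto $\ell_1'$ else goto $\ell_2'$; (5) if $I_j=I_k$ then goto $\ell_1'$ else goto $\ell_2'$; (6) $I_j:=1$; (7) $I_j:=I_j+1$; (11) goto $\ell_1'$ or goto $\ell_2'$; with $\ell_1',\ell_2'\in L_P=\{1,\ldots,\ell_P\}$. The index registers occurring in $P$ are among $I_1,\ldots,I_{k_P}$ ($k_P\ge 1$). Let $L_P^{\circ}=\{1,\ldots,\ell_P-1\}$, $L_P^{\mathrm B}$ = labels of instructions of types (4),(5),(11), $L_P^{\mathrm{NB}}=L_P^\circ\setminus L_P^{\mathrm B}$, $L_{P,\mathrm{H_T}}$ = labels of type (5), $L_{P,\mathrm H_1}$, $L_{P,\mathrm H_{+1}}$ = labels of types (6), (7). Put $\beta_P(\ell)=\ell+1$ for $\ell\in L_P^{\mathrm{NB}}$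 and, for $\ell\in L_P^{\mathrm B}$, $\beta_P^+(\ell)=\ell_1'$, $\beta_P^-(\ell)=\ell_2'$. **$P$-paths.** A finite $P$-path of length $s\ge1$ is $(\ell_1,\ldots,\ell_s)\in L_P^s$ with $\ell_1=1$, $\ell_s=\ell_P$, $\ell_t\in L_P^\circ$ for $t<s$, and for all $t<s$: $\ell_{t+1}=\beta_P(\ell_t)$ if $\ell_t\in L_P^{\mathrm{NB}}$, $\ell_{t+1}\in\{\beta_P^+(\ell_t),\beta_P^-(\ell_t)\}$ if $\ell_t\in L_P^{\mathrm B}$. An infinite $P$-path is $(\ell_1,\ell_2,\ldots)\in (L_P^\circ)^\omega$ with $\ell_1=1$ and the same successor rule for all $t\ge 1$. $\mathrm{Lab}_P^{[\le\omega]}$ consists of all infinite $P$-paths and all sequences $(\ell_1,\ldots,\ell_s,\ell_s,\ell_s,\ldots)$ with $(\ell_1,\ldots,\ell_s)$ a finite $P$-path; for $\bar\ell\in\mathrm{Lab}_P^{[\le\omega]}$, $B_{\bar\ell}$ denotes the (unique) $P$-path from which $\bar\ell$ arises in this way. **Partial configurations.** For $\ell$ of type (6) (resp. (7)) and $\vec\nu\in\mathbb N_+^\kappa$, $H_\ell^{(\kappa)}(\vec\nu)$ is obtained from $\vec\nu$ by replacing $\nu_j$ by $1$ (resp. $\nu_j+1$). For $\ell$ of type (5), $T_\ell^{(\kappa)}(\vec\nu)=\ell_1'$ if $\nu_j=\nu_k$ and $\ell_2'$ otherwise. $\mathrm{Seq}^{\mathrm{ind}}_{P,\kappa,n}$ is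 the set of sequences $(\ell_t\,.\,\vec\nu^{(t)})_{t\ge1}$ with $(\ell_t)_{t\ge1}\in\mathrm{Lab}_P^{[\le\omega]}$, $\vec\nu^{(1)}=(n,1,\ldots,1)\in\mathbb N_+^\kappa$, and for all $t\geq 1$, $\vec\nu^{(t+1)}=H_{\ell_t}^{(\kappa)}(\vec\nu^{(t)})$ if $\ell_t\in L_{P,\mathrm H_1}\cup L_{P,\mathrm H_{+1}}$ and $\vec\nu^{(t+1)}=\vec\nu^{(t)}$ otherwise. **BSS RAMs.** Let $A$ be a $\sigma$-structure with universe $U_A$; $U_A^\infty=\bigcup_{n\ge1}U_A^n$. A BSS RAM $M$ over $A$ has a $\sigma$-program $P_M$ and $k_M\ge k_{P_M}$ index registers. Its configurations are $(\ell\,.\,\vec\nu\,.\,\bar u)$ with $\ell\in L_{P_M}$, $\vec\nu\in\mathbb N_+^{k_M}$, $\bar u\in U_A^\omega$ (contents of $I_1,\ldots,I_{k_M}$ and $Z_1,Z_2,\ldots$). The step relation $\to_M$ executes $\mathrm{instruction}_\ell$ in the obvious way: types (1),(2),(3) change one component of $\bar u$ (type (3): $u_{\nu_j}$ becomes $u_{\nu_k}$), types (6),(7) change $\nu_j$, in all these cases going to label $\ell+1$; types (4),(5) only change the label, according to whether the condition holds ($\ell_1'$) or not ($\ell_2'$); type (11) only changes the label, to $\ell_1'$ or to $\ell_2'$ (both allowed); at $\ell=\ell_{P_M}$ the configuration is left unchanged. Initial configurations for input $\vec x\in U_A^n$: for $M\in\mathsf M_A$ and $M\in\mathsf M_A^{\mathrm{NDB}}$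 it is $(1\,.\,(n,1,\ldots,1)\,.\,(x_1,\ldots,x_n,x_n,x_n,\ldots))$; for $M\in\mathsf M_A^{\mathrm{ND}}$ every $(1\,.\,(n,1,\ldots,1)\,.\,(x_1,\ldots,x_n,y_1,\ldots,y_m,x_n,x_n,\ldots))$ with $(y_1,\ldots,y_m)\in U_A^\infty$; for $M\in\mathsf M_A^{\mathrm{DND}}$ the same but with $(y_1,\ldots,y_m)\in\{c_1,c_2\}^\infty$ (here $A$ is assumed to contain two designated constants $c_1,c_2$). Type (11) is allowed only for $\mathsf M_A^{\mathrm{NDB}}$. An $(M,\vec x)$-path is a sequence $(con_t)_{t\ge1}$ of configurations with $con_1$ an initial configuration for $\vec x$ and $con_t\to_M con_{t+1}$ for all $t\geq 1$. Its sequence of labels, truncated at the first occurrence of $\ell_{P_M}$ (if any), is a computation path of $M$, and $M$ is said to traverse it for $\vec x$. $\mathrm{Lab}_{M,n}$ is the set of computation paths traversed by $M$ for some input in $U_A^n$. *)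

theory Defs
  imports Main
begin

text \<open>
  Labels, register numbers and symbol numbers are counted from 1.  Tuples are lists and infinite
  sequences are functions on \<^typ>\<open>nat\<close>; since these are indexed from 0, the component with
  number \<open>i \<ge> 1\<close> of a tuple or of a sequence is stored at position \<open>i - 1\<close>.
\<close>

section \<open>Signatures, structures and programs\<close>

record signature =
  const_count :: nat
  op_arities :: "nat list"
  rel_arities :: "nat list"

record 'a fo_structure =
  univ :: "'a set"
  const_of :: "nat \<Rightarrow> 'a"
  op_of :: "nat \<Rightarrow> 'a list \<Rightarrow> 'a"
  rel_of :: "nat \<Rightarrow> 'a list set"

definition tuples :: "'a set \<Rightarrow> nat \<Rightarrow> 'a list set" where
  "tuples U n = {xs. length xs = n \<and> set xs \<subseteq> U}"

definition nonempty_tuples :: "'a set \<Rightarrow> 'a list set" where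
  "nonempty_tuples U = (\<Union>n\<in>{1..}. tuples U n)"

definition is_structure :: "signature \<Rightarrow> 'a fo_structure \<Rightarrow> bool" where
  "is_structure \<sigma> A \<longleftrightarrow>
     univ A \<noteq> {} \<and>
     (\<forall>i\<in>{1..const_count \<sigma>}. const_of A i \<in> univ A) \<and>
     (\<forall>i\<in>{1..length (op_arities \<sigma>)}.
        \<forall>xs\<in>tuples (univ A) (op_arities \<sigma> ! (i - 1)). op_of A i xs \<in> univ A) \<and>
     (\<forall>i\<in>{1..length (rel_arities \<sigma>)}. rel_of A i \<subseteq> tuples (univ A) (rel_arities \<sigma> ! (i - 1)))"

datatype instr =
    OpI nat nat "nat list"             \<comment> \<open>\<open>OpI i j js\<close>: \<open>Z_j := f_i(Z_js)\<close>\<close>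
  | ConstI nat nat                     \<comment> \<open>\<open>ConstI i j\<close>: \<open>Z_j := c_i\<close>\<close>
  | CopyI nat nat                      \<comment> \<open>\<open>CopyI j k\<close>: \<open>Z_(I_j) := Z_(I_k)\<close>\<close>
  | IfRel nat "nat list" nat nat       \<comment> \<open>\<open>IfRel i js a b\<close>: if \<open>r_i(Z_js)\<close> then goto \<open>a\<close> else goto \<open>b\<close>\<close>
  | IfIdx nat nat nat nat              \<comment> \<open>\<open>IfIdx j k a b\<close>: if \<open>I_j = I_k\<close> then goto \<open>a\<close> else goto \<open>b\<close>\<close>
  | IdxOne nat                         \<comment> \<open>\<open>I_j := 1\<close>\<close>
  | IdxInc nat                         \<comment> \<open>\<open>I_j := I_j + 1\<close>\<close>
  | GotoOr nat nat                     \<comment> \<open>goto \<open>a\<close> or goto \<open>b\<close>\<close>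
  | Stop

type_synonym program = "instr list"

definition instr_at :: "program \<Rightarrow> nat \<Rightarrow> instr" where
  "instr_at P lab = P ! (lab - 1)"

definition labels :: "program \<Rightarrow> nat set" where
  "labels P = {1..length P}"

definition inner_labels :: "program \<Rightarrow> nat set" where
  "inner_labels P = {1..<length P}"

fun is_instr :: "signature \<Rightarrow> nat set \<Rightarrow> instr \<Rightarrow> bool" where
  "is_instr \<sigma> L (OpI i j js) \<longleftrightarrow>
     i \<in> {1..length (op_arities \<sigma>)} \<and> 1 \<le> j \<and> length js = op_arities \<sigma> ! (i - 1) \<and> (\<forall>m\<in>set js. 1 \<le> m)"
| "is_instr \<sigma> L (ConstI i j) \<longleftrightarrow> i \<in> {1..const_count \<sigma>} \<and> 1 \<le> j"
| "is_instr \<sigma> L (CopyI j k) \<longleftrightarrow> 1 \<le> j \<and> 1 \<le> k"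
| "is_instr \<sigma> L (IfRel i js a b) \<longleftrightarrow>
     i \<in> {1..length (rel_arities \<sigma>)} \<and> length js = rel_arities \<sigma> ! (i - 1) \<and> (\<forall>m\<in>set js. 1 \<le> m) \<and>
     a \<in> L \<and> b \<in> L"
| "is_instr \<sigma> L (IfIdx j k a b) \<longleftrightarrow> 1 \<le> j \<and> 1 \<le> k \<and> a \<in> L \<and> b \<in> L"
| "is_instr \<sigma> L (IdxOne j) \<longleftrightarrow> 1 \<le> j"
| "is_instr \<sigma> L (IdxInc j) \<longleftrightarrow> 1 \<le> j"
| "is_instr \<sigma> L (GotoOr a b) \<longleftrightarrow> a \<in> L \<and> b \<in> L"
| "is_instr \<sigma> L Stop \<longleftrightarrow> False"

definition is_program :: "signature \<Rightarrow> program \<Rightarrow> bool" where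
  "is_program \<sigma> P \<longleftrightarrow>
     1 \<le> length P \<and> instr_at P (length P) = Stop \<and>
     (\<forall>lab\<in>inner_labels P. is_instr \<sigma> (labels P) (instr_at P lab))"

fun index_registers :: "instr \<Rightarrow> nat set" where
  "index_registers (CopyI j k) = {j, k}"
| "index_registers (IfIdx j k a b) = {j, k}"
| "index_registers (IdxOne j) = {j}"
| "index_registers (IdxInc j) = {j}"
| "index_registers _ = {}"

text \<open>The least \<open>k \<ge> 1\<close> such that all index registers occurring in the program are among
  \<open>I_1, \<dots>, I_k\<close>.\<close>

definition index_count :: "program \<Rightarrow> nat" where
  "index_count P = Max (insert 1 (\<Union>i\<in>set P. index_registers i))"

definition labels_HT :: "program \<Rightarrow> nat set" where
  "labels_HT P = {lab\<in>inner_labels P. \<exists>j k a b. instr_at P lab = IfIdx j k a b}"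

definition labels_H1 :: "program \<Rightarrow> nat set" where
  "labels_H1 P = {lab\<in>inner_labels P. \<exists>j. instr_at P lab = IdxOne j}"

definition labels_Hinc :: "program \<Rightarrow> nat set" where
  "labels_Hinc P = {lab\<in>inner_labels P. \<exists>j. instr_at P lab = IdxInc j}"

definition labels_B :: "program \<Rightarrow> nat set" where
  "labels_B P = {lab\<in>inner_labels P.
     (\<exists>i js a b. instr_at P lab = IfRel i js a b) \<or>
     (\<exists>j k a b. instr_at P lab = IfIdx j k a b) \<or>
     (\<exists>a b. instr_at P lab = GotoOr a b)}"

definition labels_NB :: "program \<Rightarrow> nat set" where
  "labels_NB P = inner_labels P - labels_B P"

definition beta :: "program \<Rightarrow> nat \<Rightarrow> nat" where
  "beta P lab = lab + 1"

definition beta_pos :: "program \<Rightarrow> nat \<Rightarrow> nat" where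
  "beta_pos P lab = (case instr_at P lab of
     IfRel i js a b \<Rightarrow> a | IfIdx j k a b \<Rightarrow> a | GotoOr a b \<Rightarrow> a | _ \<Rightarrow> undefined)"

definition beta_neg :: "program \<Rightarrow> nat \<Rightarrow> nat" where
  "beta_neg P lab = (case instr_at P lab of
     IfRel i js a b \<Rightarrow> b | IfIdx j k a b \<Rightarrow> b | GotoOr a b \<Rightarrow> b | _ \<Rightarrow> undefined)"

section \<open>Program paths\<close>

datatype path = Fin "nat list" | Inf "nat \<Rightarrow> nat"

definition succ_rule :: "program \<Rightarrow> nat \<Rightarrow> nat \<Rightarrow> bool" where
  "succ_rule P lab lab' \<longleftrightarrow>
     (lab \<in> labels_NB P \<longrightarrow> lab' = beta P lab) \<and>
     (lab \<in> labels_B P \<longrightarrow> lab' \<in> {beta_pos P lab, beta_neg P lab})"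

fun is_path :: "program \<Rightarrow> path \<Rightarrow> bool" where
  "is_path P (Fin ls) \<longleftrightarrow>
     ls \<in> nonempty_tuples (labels P) \<and> hd ls = 1 \<and> last ls = length P \<and>
     (\<forall>t. t + 1 < length ls \<longrightarrow> ls ! t \<in> inner_labels P \<and> succ_rule P (ls ! t) (ls ! (t + 1)))"
| "is_path P (Inf l) \<longleftrightarrow>
     (\<forall>t. l t \<in> inner_labels P) \<and> l 0 = 1 \<and> (\<forall>t. succ_rule P (l t) (l (t + 1)))"

fun pad_path :: "path \<Rightarrow> nat \<Rightarrow> nat" where
  "pad_path (Fin ls) = (\<lambda>t. if t < length ls then ls ! t else last ls)"
| "pad_path (Inf l) = l"

definition Lab_le_omega :: "program \<Rightarrow> (nat \<Rightarrow> nat) set" where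
  "Lab_le_omega P = pad_path ` {B. is_path P B}"

definition path_of :: "program \<Rightarrow> (nat \<Rightarrow> nat) \<Rightarrow> path" where
  "path_of P l = (THE B. is_path P B \<and> pad_path B = l)"

definition cut_path :: "program \<Rightarrow> (nat \<Rightarrow> nat) \<Rightarrow> path" where
  "cut_path P l =
     (if \<exists>t. l t = length P then Fin (map l [0..<Suc (LEAST t. l t = length P)]) else Inf l)"

lemma cut_pad_path:
  assumes "is_path P B"
  shows "cut_path P (pad_path B) = B"
proof (cases B)
  case (Fin ls)
  have ne: "ls \<noteq> []" and lst: "last ls = length P"
    and inn: "\<And>t. t + 1 < length ls \<Longrightarrow> ls ! t \<in> inner_labels P"
    using assms by (auto simp: Fin nonempty_tuples_def tuples_def)
  have at_end: "pad_path B (length ls - 1) = length P"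
    using ne lst by (simp add: Fin last_conv_nth)
  have least: "(LEAST t. pad_path B t = length P) = length ls - 1"
  proof (rule Least_equality)
    fix t assume t: "pad_path B t = length P"
    show "length ls - 1 \<le> t"
    proof (rule ccontr)
      assume "\<not> length ls - 1 \<le> t"
      then have "t + 1 < length ls" by simp
      then show False using t inn[of t] by (simp add: Fin inner_labels_def)
    qed
  qed (rule at_end)
  have "map (pad_path B) [0..<length ls] = ls"
    by (rule nth_equalityI) (simp_all add: Fin)
  moreover have "\<exists>t. pad_path B t = length P" using at_end by blast
  moreover have "Suc (length ls - 1) = length ls" using ne by (cases ls) auto
  ultimately show ?thesis unfolding cut_path_def least by (simp only: if_True Fin)
next
  case (Inf l)
  have "l t \<noteq> length P" for t
    using assms by (auto simp: Inf inner_labels_def dest!: spec[of _ t])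
  then show ?thesis by (simp add: Inf cut_path_def)
qed

lemma path_of_pad_path:
  assumes "is_path P B"
  shows "path_of P (pad_path B) = B"
  unfolding path_of_def
  by (rule the_equality) (use assms cut_pad_path in metis)+

section \<open>Partial configurations\<close>

definition index_tuples :: "nat \<Rightarrow> nat list set" where
  "index_tuples \<kappa> = tuples {1..} \<kappa>"

definition idx_update :: "program \<Rightarrow> nat \<Rightarrow> nat list \<Rightarrow> nat list" where
  "idx_update P lab \<nu> = (case instr_at P lab of
     IdxOne j \<Rightarrow> \<nu>[j - 1 := 1] | IdxInc j \<Rightarrow> \<nu>[j - 1 := \<nu> ! (j - 1) + 1] | _ \<Rightarrow> undefined)"

definition idx_test :: "program \<Rightarrow> nat \<Rightarrow> nat list \<Rightarrow> nat" where
  "idx_test P lab \<nu> = (case instr_at P lab of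
     IfIdx j k a b \<Rightarrow> if \<nu> ! (j - 1) = \<nu> ! (k - 1) then a else b | _ \<Rightarrow> undefined)"

definition start_index :: "nat \<Rightarrow> nat \<Rightarrow> nat list" where
  "start_index \<kappa> n = n # replicate (\<kappa> - 1) 1"

definition Seq_ind :: "program \<Rightarrow> nat \<Rightarrow> nat \<Rightarrow> (nat \<Rightarrow> nat \<times> nat list) set" where
  "Seq_ind P \<kappa> n = {s.
     (\<lambda>t. fst (s t)) \<in> Lab_le_omega P \<and>
     (\<forall>t. snd (s t) \<in> index_tuples \<kappa>) \<and>
     snd (s 0) = start_index \<kappa> n \<and>
     (\<forall>t. snd (s (t + 1)) =
        (if fst (s t) \<in> labels_H1 P \<union> labels_Hinc P
         then idx_update P (fst (s t)) (snd (s t)) else snd (s t)))}"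

section \<open>BSS RAMs\<close>

text \<open>\<open>DND p q\<close>: the designated constants are the interpretations of the \<open>p\<close>-th and \<open>q\<close>-th
  constant symbols.\<close>

datatype kind = Det | DND nat nat | ND | NDB

record 'a ram =
  ram_str :: "'a fo_structure"
  ram_prog :: program
  ram_idx :: nat
  ram_kind :: kind

definition is_ram :: "signature \<Rightarrow> 'a fo_structure \<Rightarrow> 'a ram \<Rightarrow> bool" where
  "is_ram \<sigma> A M \<longleftrightarrow>
     is_structure \<sigma> A \<and> ram_str M = A \<and> is_program \<sigma> (ram_prog M) \<and> index_count (ram_prog M) \<le> ram_idx M"

definition no_goto_or :: "program \<Rightarrow> bool" where
  "no_goto_or P \<longleftrightarrow> (\<forall>a b. GotoOr a b \<notin> set P)"

definition RAM_Det :: "signature \<Rightarrow> 'a fo_structure \<Rightarrow> 'a ram set" where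
  "RAM_Det \<sigma> A = {M. is_ram \<sigma> A M \<and> no_goto_or (ram_prog M) \<and> ram_kind M = Det}"

definition RAM_DND :: "signature \<Rightarrow> 'a fo_structure \<Rightarrow> 'a ram set" where
  "RAM_DND \<sigma> A = {M. is_ram \<sigma> A M \<and> no_goto_or (ram_prog M) \<and>
     (\<exists>p\<in>{1..const_count \<sigma>}. \<exists>q\<in>{1..const_count \<sigma>}. p \<noteq> q \<and> ram_kind M = DND p q)}"

definition RAM_ND :: "signature \<Rightarrow> 'a fo_structure \<Rightarrow> 'a ram set" where
  "RAM_ND \<sigma> A = {M. is_ram \<sigma> A M \<and> no_goto_or (ram_prog M) \<and> ram_kind M = ND}"

definition RAM_NDB :: "signature \<Rightarrow> 'a fo_structure \<Rightarrow> 'a ram set" where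
  "RAM_NDB \<sigma> A = {M. is_ram \<sigma> A M \<and> ram_kind M = NDB}"

text \<open>Contents of the label counter, of \<open>I_1, \<dots>, I_k\<close>, and of \<open>Z_1, Z_2, \<dots>\<close>.\<close>

type_synonym 'a config = "nat \<times> nat list \<times> (nat \<Rightarrow> 'a)"

definition configs :: "'a ram \<Rightarrow> 'a config set" where
  "configs M =
     labels (ram_prog M) \<times> index_tuples (ram_idx M) \<times> {u. range u \<subseteq> univ (ram_str M)}"

fun steps :: "'a ram \<Rightarrow> 'a config \<Rightarrow> 'a config set" where
  "steps M (lab, \<nu>, u) = (case instr_at (ram_prog M) lab of
     OpI i j js \<Rightarrow> {(lab + 1, \<nu>, u(j - 1 := op_of (ram_str M) i (map (\<lambda>m. u (m - 1)) js)))}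
   | ConstI i j \<Rightarrow> {(lab + 1, \<nu>, u(j - 1 := const_of (ram_str M) i))}
   | CopyI j k \<Rightarrow> {(lab + 1, \<nu>, u(\<nu> ! (j - 1) - 1 := u (\<nu> ! (k - 1) - 1)))}
   | IfRel i js a b \<Rightarrow>
       {(if map (\<lambda>m. u (m - 1)) js \<in> rel_of (ram_str M) i then a else b, \<nu>, u)}
   | IfIdx j k a b \<Rightarrow> {(if \<nu> ! (j - 1) = \<nu> ! (k - 1) then a else b, \<nu>, u)}
   | IdxOne j \<Rightarrow> {(lab + 1, \<nu>[j - 1 := 1], u)}
   | IdxInc j \<Rightarrow> {(lab + 1, \<nu>[j - 1 := \<nu> ! (j - 1) + 1], u)}
   | GotoOr a b \<Rightarrow> {(a, \<nu>, u), (b, \<nu>, u)}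
   | Stop \<Rightarrow> {(lab, \<nu>, u)})"

definition fill :: "'a list \<Rightarrow> 'a \<Rightarrow> nat \<Rightarrow> 'a" where
  "fill xs a = (\<lambda>i. if i < length xs then xs ! i else a)"

definition guesses :: "'a ram \<Rightarrow> 'a list set" where
  "guesses M = (case ram_kind M of
     Det \<Rightarrow> {[]}
   | NDB \<Rightarrow> {[]}
   | ND \<Rightarrow> nonempty_tuples (univ (ram_str M))
   | DND p q \<Rightarrow> nonempty_tuples {const_of (ram_str M) p, const_of (ram_str M) q})"

definition initials :: "'a ram \<Rightarrow> 'a list \<Rightarrow> 'a config set" where
  "initials M xs =
     {(1, start_index (ram_idx M) (length xs), fill (xs @ ys) (last xs)) | ys. ys \<in> guesses M}"

definition is_run :: "'a ram \<Rightarrow> 'a list \<Rightarrow> (nat \<Rightarrow> 'a config) \<Rightarrow> bool" where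
  "is_run M xs con \<longleftrightarrow>
     (\<forall>t. con t \<in> configs M) \<and> con 0 \<in> initials M xs \<and> (\<forall>t. con (t + 1) \<in> steps M (con t))"

definition traverses :: "'a ram \<Rightarrow> 'a list \<Rightarrow> path \<Rightarrow> bool" where
  "traverses M xs B \<longleftrightarrow> (\<exists>con. is_run M xs con \<and> B = cut_path (ram_prog M) (\<lambda>t. fst (con t)))"

definition Lab :: "'a ram \<Rightarrow> nat \<Rightarrow> path set" where
  "Lab M n = {B. \<exists>xs\<in>tuples (univ (ram_str M)) n. traverses M xs B}"

end

theory Submission
  imports Defs
begin

text \<open>
  The type-(5) successor in a run depends only on the index registers, and their evolution depends
  only on the labels traversed.  So a run traversing the path has the partial configurations of the
  given sequence and would have to obey all its index tests.
\<close>

text \<open>Because the stop label is absorbing, truncating at its first occurrence loses no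
  information: two such label sequences with equal cut paths coincide at every time.\<close>

lemma pad_cut_path:
  assumes "\<And>t. l t = length P \<Longrightarrow> l (Suc t) = length P"
  shows "pad_path (cut_path P l) = l"
proof (cases "\<exists>t. l t = length P")
  case True
  define N where "N = (LEAST t. l t = length P)"
  have N: "l N = length P"
    using True unfolding N_def by (rule LeastI_ex)
  have "l t = length P" if "N \<le> t" for t
    using that by (induction t rule: dec_induct) (use N assms in auto)
  \<comment> \<open>The cut list ends with \<open>l N\<close>, which is the stop label, so padding
    repeats exactly the value that \<open>l\<close> keeps from \<open>N\<close> on.\<close>
  then have "pad_path (Fin (map l [0..<Suc N])) = l"
    using N by (auto simp: fun_eq_iff nth_append less_Suc_eq)
  then show ?thesis
    using True by (simp add: cut_path_def N_def)
next
  case False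
  then show ?thesis by (simp add: cut_path_def)
qed

lemma step_at_stop:
  assumes "is_program \<sigma> (ram_prog M)" "fst c = length (ram_prog M)" "c' \<in> steps M c"
  shows "c' = c"
  using assms by (cases c) (auto simp: is_program_def)

text \<open>Only types (6) and (7) write to an index register; type (3) merely reads them as
  addresses. Hence neither the contents of the Z-registers nor a nondeterministic choice of branch
  affects the new index tuple.\<close>

lemma step_index:
  assumes "is_program \<sigma> (ram_prog M)" "fst c \<in> labels (ram_prog M)" "c' \<in> steps M c"
  shows "fst (snd c') =
    (if fst c \<in> labels_H1 (ram_prog M) \<union> labels_Hinc (ram_prog M)
     then idx_update (ram_prog M) (fst c) (fst (snd c)) else fst (snd c))"
proof (cases "fst c = length (ram_prog M)")
  case True
  \<comment> \<open>The stop label is not an inner label, so the conditional takes its else branch,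
    which matches the unchanged configuration.\<close>
  then show ?thesis
    using step_at_stop[OF assms(1) True assms(3)]
    by (auto simp: labels_H1_def labels_Hinc_def inner_labels_def)
next
  case False
  then have "fst c \<in> inner_labels (ram_prog M)"
    using assms(2) by (auto simp: labels_def inner_labels_def)
  then show ?thesis
    using assms(3)
    by (cases c) (auto simp: labels_H1_def labels_Hinc_def idx_update_def split: instr.splits)
qed

lemma step_idx_test:
  assumes "fst c \<in> labels_HT (ram_prog M)" "c' \<in> steps M c"
  shows "fst c' = idx_test (ram_prog M) (fst c) (fst (snd c))"
  using assms by (cases c) (auto simp: labels_HT_def idx_test_def)

text \<open>Since \<open>seq\<close> pairs \<open>\<nu>\<close> with the labels of the run itself,
  both index sequences start at the same tuple and satisfy the same recursion. The guesses of a
  nondeterministic machine enter only the Z-registers of the initial configuration.\<close>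

lemma run_index:
  assumes prog: "is_program \<sigma> (ram_prog M)"
    and run: "is_run M xs con"
    and seq: "(\<lambda>t. (fst (con t), \<nu> t)) \<in> Seq_ind (ram_prog M) (ram_idx M) (length xs)"
  shows "fst (snd (con t)) = \<nu> t"
proof (induction t)
  case 0
  show ?case
    using run seq by (auto simp: is_run_def initials_def Seq_ind_def)
next
  case (Suc t)
  have "fst (con t) \<in> labels (ram_prog M)"
    using run by (auto simp: is_run_def configs_def mem_Times_iff)
  moreover have "con (Suc t) \<in> steps M (con t)"
    using run by (simp add: is_run_def)
  ultimately show ?case
    using step_index[OF prog] seq Suc by (simp add: Seq_ind_def)
qed

theorem theorem3p13:
  fixes \<sigma> :: signature and P :: program and \<kappa> n :: nat
    and A :: "'a fo_structure" and M :: "'a ram"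
    and l :: "nat \<Rightarrow> nat" and \<nu> :: "nat \<Rightarrow> nat list"
  assumes "is_program \<sigma> P"
    and "\<kappa> \<ge> index_count P"
    and "n \<ge> 1"
    and "is_structure \<sigma> A"
    and "M \<in> RAM_Det \<sigma> A \<union> RAM_DND \<sigma> A \<union> RAM_ND \<sigma> A \<union> RAM_NDB \<sigma> A"
    and "ram_prog M = P"
    and "ram_idx M = \<kappa>"
    and "(\<lambda>t. (l t, \<nu> t)) \<in> Seq_ind P \<kappa> n"
    and "\<exists>t. l t \<in> labels_HT P \<and> l (t + 1) \<noteq> idx_test P (l t) (\<nu> t)"
  shows "path_of P l \<notin> Lab M n"
proof
  assume "path_of P l \<in> Lab M n"
  then obtain xs con where len: "length xs = n" and run: "is_run M xs con"
    and cut: "path_of P l = cut_path P (\<lambda>t. fst (con t))"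
    using \<open>ram_prog M = P\<close> by (auto simp: Lab_def tuples_def traverses_def)
  have step: "con (Suc t) \<in> steps M (con t)" for t
    using run by (simp add: is_run_def)
  have "l \<in> Lab_le_omega P"
    using assms(8) by (simp add: Seq_ind_def)
  \<comment> \<open>As \<open>l\<close> is a padded path, the definite description in
    \<open>path_of\<close> is well defined and padding undoes it.\<close>
  then have "pad_path (path_of P l) = l"
    using path_of_pad_path by (auto simp: Lab_le_omega_def)
  moreover have "fst (con (Suc t)) = length P" if "fst (con t) = length P" for t
    using step_at_stop[OF _ _ step] assms(1) that \<open>ram_prog M = P\<close> by metis
  then have "pad_path (cut_path P (\<lambda>t. fst (con t))) = (\<lambda>t. fst (con t))"
    by (rule pad_cut_path)
  ultimately have l: "l = (\<lambda>t. fst (con t))"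
    using cut by simp
  have "fst (snd (con t)) = \<nu> t" for t
    by (rule run_index[OF _ run]) (use assms l len in auto)
  \<comment> \<open>At the violated test, the run has label \<open>l t\<close> and index tuple
    \<open>\<nu> t\<close>, so its next label must be the test value.\<close>
  then show False
    using assms(9) step_idx_test[OF _ step] l \<open>ram_prog M = P\<close> by auto
qed

end
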